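(* Let $a,b\in\mathbb{H}$ be similar (nonreal) quaternions. Then the nonzero solutions $x\in\mathbb{H}$ of the homogeneous singular Sylvester equation $ax-xb=0$ are exactly the quaternions of the form $$x=\lambda\sqrt{(\mathrm{Im}\,a)(\mathrm{Im}\,b)^{*}}+\mu\,\mathrm{Im}(a+b),$$ with $\lambda,\mu$ arbitrary real numbers satisfying $|\lambda|+|\mu\,\mathrm{Im}(a+b)|\neq 0$, where in the case $\mathrm{Im}\,a=-\mathrm{Im}\,b$ the quaternion $x$ must additionally satisfy $\mathrm{Im}\,a\cdot\mathrm{Im}\,x=0$. Explicitly: a quaternion $x$ satisfies $x\neq 0$ and $ax-xb=0$ if and only if there exist $\lambda,\mu\in\mathbb{R}$ with $|\lambda|+|\mu\,\mathrm{Im}(a+b)|\neq0$ and a quaternion $s$ with $s^2=(\mathrm{Im}\,a)(\mathrm{Im}\,b)^{*}$ such that $x=\lambda s+\mu\,\mathrm{Im}(a+b)$ and, if $\mathrm{Im}\,a=-\mathrm{Im}\,b$, also $\mathrm{Im}\,a\cdot\mathrm{Im}\,x=0$.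
   Context: $\mathbb{H}$ is the real quaternion algebra. For $a=a_0+a_1i+a_2j+a_3k$, $\mathrm{Re}\,a=a_0$, $\mathrm{Im}\,a=a_1i+a_2j+a_3k$ (the vector part), $a^*=\mathrm{Re}\,a-\mathrm{Im}\,a$, $|a|=\sqrt{aa^*}$. The dot product $\cdot$ of two pure quaternions (zero real part) is the Euclidean scalar product of the corresponding vectors in $\mathbb{R}^3$. Two nonreal quaternions $a,b$ are called similar if there is a nonzero quaternion $p$ with $p^{-1}ap=b$. For a nonzero quaternion $d$, $\sqrt{d}$ denotes any solution $s\in\mathbb{H}$ of $s^2=d$ (there are two solutions $\pm s$ if $d$ is nonreal or a positive real, and infinitely many if $d$ is a negative real). *)

theory Defs
  imports "HOL-Analysis.Analysis"
begin

codatatype quat = Quat (qRe: real) (qI: real) (qJ: real) (qK: real)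

lemma quat_eq_iff: "x = y \<longleftrightarrow> qRe x = qRe y \<and> qI x = qI y \<and> qJ x = qJ y \<and> qK x = qK y"
  by (auto intro: quat.expand)

instantiation quat :: ab_group_add
begin

primcorec zero_quat where
  "qRe 0 = 0"
| "qI 0 = 0"
| "qJ 0 = 0"
| "qK 0 = 0"

primcorec plus_quat where
  "qRe (x + y) = qRe x + qRe y"
| "qI (x + y) = qI x + qI y"
| "qJ (x + y) = qJ x + qJ y"
| "qK (x + y) = qK x + qK y"

primcorec uminus_quat where
  "qRe (- x) = - qRe x"
| "qI (- x) = - qI x"
| "qJ (- x) = - qJ x"
| "qK (- x) = - qK x"

primcorec minus_quat where
  "qRe (x - y) = qRe x - qRe y"
| "qI (x - y) = qI x - qI y"
| "qJ (x - y) = qJ x - qJ y"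
| "qK (x - y) = qK x - qK y"

instance
  by standard (simp_all add: quat_eq_iff)

end

instantiation quat :: ring_1
begin

primcorec one_quat where
  "qRe 1 = 1"
| "qI 1 = 0"
| "qJ 1 = 0"
| "qK 1 = 0"

primcorec times_quat where
  "qRe (x * y) = qRe x * qRe y - qI x * qI y - qJ x * qJ y - qK x * qK y"
| "qI (x * y) = qRe x * qI y + qI x * qRe y + qJ x * qK y - qK x * qJ y"
| "qJ (x * y) = qRe x * qJ y - qI x * qK y + qJ x * qRe y + qK x * qI y"
| "qK (x * y) = qRe x * qK y + qI x * qJ y - qJ x * qI y + qK x * qRe y"

instance
  by standard (simp_all add: quat_eq_iff algebra_simps)

end

instantiation quat :: real_algebra_1
begin

primcorec scaleR_quat where
  "qRe (scaleR r x) = r * qRe x"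
| "qI (scaleR r x) = r * qI x"
| "qJ (scaleR r x) = r * qJ x"
| "qK (scaleR r x) = r * qK x"

instance
  by standard (simp_all add: quat_eq_iff algebra_simps)

end

lemma qRe_of_real [simp]: "qRe (of_real r) = r"
  and qI_of_real [simp]: "qI (of_real r) = 0"
  and qJ_of_real [simp]: "qJ (of_real r) = 0"
  and qK_of_real [simp]: "qK (of_real r) = 0"
  by (simp_all add: of_real_def)

text \<open>The Euclidean inner product of \<open>\<real>\<^sup>4\<close>. On pure quaternions it is the dot product
  of \<open>\<real>\<^sup>3\<close>. The induced norm is the quaternion modulus, see \<open>norm_quat_eq\<close> below.\<close>

instantiation quat :: real_inner
begin

definition inner_quat :: "quat \<Rightarrow> quat \<Rightarrow> real" where
  "inner_quat x y = qRe x * qRe y + qI x * qI y + qJ x * qJ y + qK x * qK y"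

definition norm_quat :: "quat \<Rightarrow> real" where
  "norm_quat x = sqrt (inner x x)"

definition sgn_quat :: "quat \<Rightarrow> quat" where
  "sgn_quat x = x /\<^sub>R norm x"

definition dist_quat :: "quat \<Rightarrow> quat \<Rightarrow> real" where
  "dist_quat x y = norm (x - y)"

definition uniformity_quat :: "(quat \<times> quat) filter" where
  "uniformity_quat = (INF e\<in>{0<..}. principal {(x, y). dist x y < e})"

definition open_quat :: "quat set \<Rightarrow> bool" where
  "open_quat U \<longleftrightarrow> (\<forall>x\<in>U. eventually (\<lambda>(x', y). x' = x \<longrightarrow> y \<in> U) uniformity)"

instance
proof
  fix x :: quat
  show "inner x x = 0 \<longleftrightarrow> x = 0"
    unfolding inner_quat_def quat_eq_iff
    by (auto simp: add_nonneg_eq_0_iff)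
qed (simp_all add: inner_quat_def norm_quat_def sgn_quat_def dist_quat_def
      uniformity_quat_def open_quat_def algebra_simps)

end

text \<open>The vector part, as a pure quaternion.\<close>

primcorec qIm :: "quat \<Rightarrow> quat" where
  "qRe (qIm x) = 0"
| "qI (qIm x) = qI x"
| "qJ (qIm x) = qJ x"
| "qK (qIm x) = qK x"

definition qcnj :: "quat \<Rightarrow> quat" where
  "qcnj x = of_real (qRe x) - qIm x"

lemma norm_quat_power2: "(norm (x::quat))\<^sup>2 = (qRe x)\<^sup>2 + (qI x)\<^sup>2 + (qJ x)\<^sup>2 + (qK x)\<^sup>2"
  by (simp add: norm_quat_def inner_quat_def power2_eq_square)

lemma mult_qcnj: "x * qcnj x = of_real ((norm x)\<^sup>2)"
  unfolding norm_quat_power2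
  by (simp add: quat_eq_iff qcnj_def power2_eq_square)

lemma qcnj_mult: "qcnj x * x = of_real ((norm x)\<^sup>2)"
  unfolding norm_quat_power2
  by (simp add: quat_eq_iff qcnj_def power2_eq_square)

lemma norm_quat_eq: "norm x = sqrt (qRe (x * qcnj x))"
  by (simp add: mult_qcnj del: of_real_power)

instantiation quat :: real_normed_div_algebra
begin

definition inverse_quat :: "quat \<Rightarrow> quat" where
  "inverse_quat x = qcnj x /\<^sub>R (norm x)\<^sup>2"

definition divide_quat :: "quat \<Rightarrow> quat \<Rightarrow> quat" where
  "divide_quat x y = x * inverse y"

instance
proof
  fix x y :: quat
  show "x \<noteq> 0 \<Longrightarrow> inverse x * x = 1"
    unfolding inverse_quat_def mult_scaleR_left mult_scaleR_right qcnj_mult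
    by (simp add: quat_eq_iff del: of_real_power)
  show "x \<noteq> 0 \<Longrightarrow> x * inverse x = 1"
    unfolding inverse_quat_def mult_scaleR_left mult_scaleR_right mult_qcnj
    by (simp add: quat_eq_iff del: of_real_power)
  show "x div y = x * inverse y"
    by (simp add: divide_quat_def)
  show "inverse (0::quat) = 0"
    by (simp add: inverse_quat_def qcnj_def quat_eq_iff)
  have "(norm (x * y))\<^sup>2 = (norm x * norm y)\<^sup>2"
    unfolding power_mult_distrib norm_quat_power2
    by (simp add: power2_eq_square algebra_simps)
  then show "norm (x * y) = norm x * norm y"
    by (simp add: power2_eq_iff_nonneg)
qed

end

definition quat_similar :: "quat \<Rightarrow> quat \<Rightarrow> bool" where
  "quat_similar a b \<longleftrightarrow> (\<exists>p. p \<noteq> 0 \<and> inverse p * a * p = b)"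

end

theory Submission
  imports Defs
begin

text \<open>Write \<open>u = Im a\<close>, \<open>v = Im b\<close>, \<open>w = u v\<^sup>*\<close>. Similarity forces \<open>Re a = Re b\<close> and \<open>|u| = |v|\<close>, so
  the equation becomes \<open>u x = x v\<close>. If \<open>u + v \<noteq> 0\<close>, both \<open>u + v\<close> and \<open>y = |u|\<^sup>2 + w\<close> solve it; every
  square root \<open>s\<close> of \<open>w\<close> satisfies \<open>2 (Re s) s = s\<^sup>2 + s s\<^sup>* = y\<close>, so it is a solution with nonzero
  real part, and a solution with vanishing real part is parallel to \<open>u + v\<close>. If \<open>u + v = 0\<close>, the
  square roots of \<open>w = -|u|\<^sup>2\<close> are the pure quaternions of modulus \<open>|u|\<close>, and the solutions are the
  pure quaternions orthogonal to \<open>u\<close>.\<close>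

lemma qRe_mult_commute: "qRe (x * y) = qRe (y * x)"
  by (simp add: algebra_simps)

lemma qcnj_pure: "qRe x = 0 \<Longrightarrow> qcnj x = - x"
  by (simp add: qcnj_def quat_eq_iff)

lemma norm_qcnj: "norm (qcnj x) = norm x"
  by (simp add: norm_quat_def inner_quat_def qcnj_def)

lemma square_pure: "qRe x = 0 \<Longrightarrow> x * x = - of_real ((norm x)\<^sup>2)"
  using mult_qcnj[of x] by (simp add: qcnj_pure del: of_real_power) (metis minus_minus)

text \<open>Multiply \<open>qcnj x = 2 Re x - x\<close> by \<open>x\<close>: this is the quadratic
  equation with trace \<open>2 Re x\<close> and norm \<open>|x|^2\<close>.\<close>

lemma quat_square: "x * x = (2 * qRe x) *\<^sub>R x - of_real ((norm x)\<^sup>2)"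
  unfolding norm_quat_power2
  by (simp add: quat_eq_iff power2_eq_square del: of_real_add of_real_mult)

lemma quat_eq_Re_plus_Im: "a = of_real (qRe a) + qIm a"
  by (simp add: quat_eq_iff)

lemma qIm_eq_0_iff: "qIm a = 0 \<longleftrightarrow> a \<in> \<real>"
proof
  assume "qIm a = 0"
  then have "a = of_real (qRe a)" using quat_eq_Re_plus_Im[of a] by simp
  then show "a \<in> \<real>" by (metis Reals_of_real)
qed (auto simp: Reals_def quat_eq_iff)

lemma norm_qIm: "(norm (qIm a))\<^sup>2 = (norm a)\<^sup>2 - (qRe a)\<^sup>2"
  by (simp add: norm_quat_power2)

text \<open>\<open>qRe\<close> behaves like a trace, so cyclic permutation removes \<open>p\<close>;
  the norm is multiplicative, and \<open>norm_qIm\<close> then gives the vector parts.\<close>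

lemma quat_similarD:
  assumes "quat_similar a b"
  shows "qRe a = qRe b" "norm (qIm a) = norm (qIm b)"
proof -
  obtain p where p: "p \<noteq> 0" "inverse p * a * p = b"
    using assms unfolding quat_similar_def by blast
  have "qRe b = qRe (p * (inverse p * a))"
    using p(2) qRe_mult_commute[of "inverse p * a" p] by simp
  also have "p * (inverse p * a) = a"
    using p(1) by (simp flip: mult.assoc)
  finally show re: "qRe a = qRe b" by simp
  have "norm b = norm a"
    using p by (auto simp: norm_mult norm_inverse)
  then show "norm (qIm a) = norm (qIm b)"
    using re norm_qIm[of a] norm_qIm[of b] by (metis norm_ge_zero power2_eq_iff_nonneg)
qed

lemma sylvester_vector_part:
  assumes "qRe a = qRe b"
  shows "a * x - x * b = 0 \<longleftrightarrow> qIm a * x = x * qIm b"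
proof -
  have "a * x - x * b = qIm a * x - x * qIm b"
    using assms by (simp add: quat_eq_iff algebra_simps)
  then show ?thesis by simp
qed

context
  fixes u v :: quat
  assumes pure: "qRe u = 0" "qRe v = 0" and norm_eq: "norm u = norm v"
begin

text \<open>Holds because \<open>u * u = v * v\<close>, both being \<open>-|u|^2\<close>.\<close>

lemma sylvester_sum_solution: "u * (u + v) = (u + v) * v"
  using pure norm_eq by (simp add: ring_distribs square_pure)

text \<open>The first two identities make \<open>y\<close> a solution of
  \<open>u * y = y * v\<close>; the third makes \<open>y / |u + v|\<close> a square root of
  \<open>u * qcnj v\<close> when \<open>u + v\<close> is nonzero.\<close>

lemma scaled_sqrt_properties:
  defines "y \<equiv> of_real ((norm u)\<^sup>2) + u * qcnj v"
  shows "u * y = (norm u)\<^sup>2 *\<^sub>R (u + v)" "y * v = (norm u)\<^sup>2 *\<^sub>R (u + v)"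
    "y * y = (norm (u + v))\<^sup>2 *\<^sub>R (u * qcnj v)"
proof -
  have uu: "u * u = - of_real ((norm u)\<^sup>2)" and vv: "v * v = - of_real ((norm u)\<^sup>2)"
    using pure norm_eq by (simp_all add: square_pure)
  have y: "y = of_real ((norm u)\<^sup>2) - u * v"
    using pure by (simp add: y_def qcnj_pure)
  have "u * y = u * of_real ((norm u)\<^sup>2) - (u * u) * v"
    by (simp add: y ring_distribs mult.assoc)
  then show "u * y = (norm u)\<^sup>2 *\<^sub>R (u + v)"
    unfolding uu by (simp add: quat_eq_iff algebra_simps del: of_real_power)
  have "y * v = of_real ((norm u)\<^sup>2) * v - u * (v * v)"
    by (simp add: y ring_distribs mult.assoc)
  then show "y * v = (norm u)\<^sup>2 *\<^sub>R (u + v)"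
    unfolding vv by (simp add: quat_eq_iff algebra_simps del: of_real_power)
  define w where "w = u * qcnj v"
  have nw: "norm w = (norm u)\<^sup>2"
    using norm_eq by (simp add: w_def norm_mult norm_qcnj power2_eq_square)
  \<comment> \<open>Law of cosines: for pure \<open>u\<close> and \<open>v\<close>,
    \<open>qRe w\<close> is their dot product.\<close>
  have "(norm (u + v))\<^sup>2 = (norm u)\<^sup>2 + (norm v)\<^sup>2 + 2 * qRe w"
    using pure unfolding norm_quat_power2
    by (simp add: w_def qcnj_def power2_eq_square algebra_simps)
  then have nuv: "(norm (u + v))\<^sup>2 = 2 * (norm u)\<^sup>2 + 2 * qRe w"
    using norm_eq by simp
  have "y * y = of_real ((norm u)\<^sup>2 * (norm u)\<^sup>2) + (2 * (norm u)\<^sup>2) *\<^sub>R w + w * w"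
    unfolding y_def w_def[symmetric]
    by (simp add: quat_eq_iff algebra_simps del: of_real_power of_real_mult)
  \<comment> \<open>Expanding \<open>w * w\<close> by \<open>quat_square\<close> contributes
    \<open>-|w|^2 = -|u|^4\<close>, which cancels the constant term; the coefficient left on
    \<open>w\<close> is \<open>2 |u|^2 + 2 Re w\<close>.\<close>
  also have "\<dots> = (norm (u + v))\<^sup>2 *\<^sub>R w"
    unfolding quat_square[of w] nw nuv
    by (simp add: quat_eq_iff power2_eq_square algebra_simps del: of_real_power of_real_mult)
  finally show "y * y = (norm (u + v))\<^sup>2 *\<^sub>R (u * qcnj v)" by (simp add: w_def)
qed

lemma exists_sqrt:
  assumes "u + v \<noteq> 0"
  shows "\<exists>s. s\<^sup>2 = u * qcnj v"
proof -
  let ?y = "of_real ((norm u)\<^sup>2) + u * qcnj v"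
  have "(?y /\<^sub>R norm (u + v))\<^sup>2 = (?y * ?y) /\<^sub>R (norm (u + v))\<^sup>2"
    by (simp add: power2_eq_square)
  also have "\<dots> = u * qcnj v"
    using assms by (subst scaled_sqrt_properties(3)) simp
  finally show ?thesis by blast
qed

text \<open>Since \<open>|s| = |u|\<close>, \<open>quat_square\<close> gives
  \<open>2 (Re s) s = y\<close>. Here \<open>y\<close> is nonzero because
  \<open>u * y = |u|^2 (u + v)\<close> is, so \<open>s\<close> is a real multiple of the solution
  \<open>y\<close>.\<close>

lemma sqrt_solution:
  assumes ne: "u + v \<noteq> 0" "u \<noteq> 0" and s: "s\<^sup>2 = u * qcnj v"
  shows "qRe s \<noteq> 0" "u * s = s * v"
proof -
  let ?y = "of_real ((norm u)\<^sup>2) + u * qcnj v"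
  have "norm (s\<^sup>2) = (norm u)\<^sup>2"
    unfolding s using norm_eq by (simp add: norm_mult norm_qcnj power2_eq_square)
  then have "(norm s)\<^sup>2 = (norm u)\<^sup>2" by (simp add: norm_power)
  then have y: "(2 * qRe s) *\<^sub>R s = ?y"
    using quat_square[of s] s by (simp add: power2_eq_square algebra_simps)
  have uy: "u * ?y = (norm u)\<^sup>2 *\<^sub>R (u + v)" and yv: "?y * v = (norm u)\<^sup>2 *\<^sub>R (u + v)"
    by (rule scaled_sqrt_properties)+
  show re: "qRe s \<noteq> 0"
  proof
    assume "qRe s = 0"
    then have "?y = 0" using y by simp
    then show False using uy ne by (metis mult_zero_right scaleR_eq_0_iff norm_eq_zero power_eq_0_iff)
  qed
  have "(2 * qRe s) *\<^sub>R (u * s) = (2 * qRe s) *\<^sub>R (s * v)"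
    using uy yv unfolding y[symmetric] by simp
  then show "u * s = s * v" using re by simp
qed

text \<open>For pure \<open>x\<close>, the vector part of \<open>u * x = x * v\<close> says that the
  cross product of \<open>u + v\<close> and \<open>x\<close> vanishes.\<close>

lemma pure_solution_parallel:
  assumes ne: "u + v \<noteq> 0" and x: "u * x = x * v" "qRe x = 0"
  shows "\<exists>m. x = m *\<^sub>R (u + v)"
proof -
  define d where "d = u + v"
  have d0: "qRe d = 0" using pure by (simp add: d_def)
  have cross: "qJ d * qK x = qK d * qJ x" "qK d * qI x = qI d * qK x" "qI d * qJ x = qJ d * qI x"
    using x pure by (simp_all add: quat_eq_iff d_def algebra_simps)
  \<comment> \<open>One coordinate of \<open>|d|^2 x = (d \<bullet> x) d\<close>; the other two
    follow by cyclic permutation.\<close>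
  have parallel: "(D1 * D1 + D2 * D2 + D3 * D3) * X1 = (D1 * X1 + D2 * X2 + D3 * X3) * D1"
    if "D1 * X2 = D2 * X1" "D3 * X1 = D1 * X3" for D1 D2 D3 X1 X2 X3 :: real
    using that by algebra
  have "(d \<bullet> d) *\<^sub>R x = (d \<bullet> x) *\<^sub>R d"
    using parallel[OF cross(3,2)] parallel[OF cross(1,3)] parallel[OF cross(2,1)] d0 x(2)
    by (simp add: quat_eq_iff inner_quat_def ac_simps)
  moreover have "d \<bullet> d \<noteq> 0" using ne by (simp add: d_def)
  ultimately have "x = inverse (d \<bullet> d) *\<^sub>R ((d \<bullet> x) *\<^sub>R d)"
    by (simp flip: \<open>(d \<bullet> d) *\<^sub>R x = (d \<bullet> x) *\<^sub>R d\<close>)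
  then have "x = (inverse (d \<bullet> d) * (d \<bullet> x)) *\<^sub>R d" by (simp only: scaleR_scaleR)
  then show ?thesis unfolding d_def by blast
qed

end

text \<open>The anticommutator \<open>u * x + x * u\<close> splits into a real multiple of the pure
  \<open>u\<close> and a real number, which must vanish separately.\<close>

lemma anticommute_pure_iff:
  assumes "qRe u = 0" "u \<noteq> 0"
  shows "u * x = - (x * u) \<longleftrightarrow> qRe x = 0 \<and> u \<bullet> x = 0"
proof -
  have "u * x + x * u = (2 * qRe x) *\<^sub>R u - of_real (2 * (u \<bullet> x))"
    using assms(1) by (simp add: quat_eq_iff inner_quat_def algebra_simps del: of_real_mult)
  moreover have "(2 * qRe x) *\<^sub>R u - of_real (2 * (u \<bullet> x)) = 0 \<longleftrightarrow> qRe x = 0 \<and> u \<bullet> x = 0"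
    using assms by (auto simp: quat_eq_iff simp del: of_real_mult)
  ultimately show ?thesis by (simp add: eq_neg_iff_add_eq_0)
qed

text \<open>The vector part of \<open>s * s\<close> is \<open>2 (Re s) Im s\<close>. A nonzero real
  part would make \<open>s\<close> real, and a real square is never negative.\<close>

lemma square_eq_neg_real_imp_pure:
  assumes "s\<^sup>2 = - of_real (r\<^sup>2)" "r \<noteq> 0"
  shows "qRe s = 0"
proof (rule ccontr)
  assume re: "qRe s \<noteq> 0"
  have im: "qI s = 0" "qJ s = 0" "qK s = 0"
    using assms(1) re
    by (auto simp: quat_eq_iff power2_eq_square algebra_simps simp del: of_real_mult of_real_power)
  have "qRe s * qRe s - qI s * qI s - qJ s * qJ s - qK s * qK s = - r\<^sup>2"
    using assms(1) by (simp add: quat_eq_iff power2_eq_square del: of_real_power)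
  then have "(qRe s)\<^sup>2 + r\<^sup>2 = 0" using im by (simp add: power2_eq_square)
  then show False using assms(2) by simp
qed

lemma qIm_add: "qIm (a + b) = qIm a + qIm b"
  by (simp add: quat_eq_iff)

theorem theorem4p3:
  fixes a b :: quat
  assumes "a \<notin> \<real>" and "b \<notin> \<real>" and "quat_similar a b"
  shows "\<forall>x. (x \<noteq> 0 \<and> a * x - x * b = 0) \<longleftrightarrow>
    (\<exists>(lam::real) (mu::real) (s::quat).
        \<bar>lam\<bar> + norm (mu *\<^sub>R qIm (a + b)) \<noteq> 0 \<and>
        s\<^sup>2 = qIm a * qcnj (qIm b) \<and>
        x = lam *\<^sub>R s + mu *\<^sub>R qIm (a + b) \<and>
        (qIm a = - qIm b \<longrightarrow> qIm a \<bullet> qIm x = 0))"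
proof -
  define u v where "u = qIm a" and "v = qIm b"
  have pure: "qRe u = 0" "qRe v = 0" by (simp_all add: u_def v_def)
  have u0: "u \<noteq> 0" using assms(1) by (simp add: u_def qIm_eq_0_iff)
  have norm_eq: "norm u = norm v"
    using quat_similarD(2)[OF assms(3)] by (simp add: u_def v_def)
  have eq: "a * x - x * b = 0 \<longleftrightarrow> u * x = x * v" for x
    unfolding u_def v_def by (rule sylvester_vector_part) (rule quat_similarD(1)[OF assms(3)])
  have "(x \<noteq> 0 \<and> u * x = x * v) \<longleftrightarrow>
    (\<exists>lam mu s. \<bar>lam\<bar> + norm (mu *\<^sub>R (u + v)) \<noteq> 0 \<and> s\<^sup>2 = u * qcnj v \<and>
        x = lam *\<^sub>R s + mu *\<^sub>R (u + v) \<and> (u = - v \<longrightarrow> u \<bullet> qIm x = 0))" (is "?L \<longleftrightarrow> ?R") for x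
  proof (cases "u + v = 0")
    case False
    then have uv: "u \<noteq> - v" by (simp add: eq_neg_iff_add_eq_0)
    note sol = sqrt_solution[OF pure norm_eq False u0]
    show ?thesis
    proof
      assume L: ?L
      obtain s where s: "s\<^sup>2 = u * qcnj v"
        using exists_sqrt[OF pure norm_eq False] by blast
      \<comment> \<open>This choice cancels the real part of \<open>x - lam *\<^sub>R s\<close>,
        leaving a pure solution.\<close>
      define lam where "lam = qRe x / qRe s"
      have "u * (x - lam *\<^sub>R s) = (x - lam *\<^sub>R s) * v" "qRe (x - lam *\<^sub>R s) = 0"
        using L sol[OF s] by (simp_all add: algebra_simps lam_def)
      then obtain mu where "x - lam *\<^sub>R s = mu *\<^sub>R (u + v)"
        using pure_solution_parallel[OF pure norm_eq False] by blast
      then have x: "x = lam *\<^sub>R s + mu *\<^sub>R (u + v)" by (simp add: diff_eq_eq add.commute)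
      have "\<bar>lam\<bar> + norm (mu *\<^sub>R (u + v)) \<noteq> 0"
      proof
        assume "\<bar>lam\<bar> + norm (mu *\<^sub>R (u + v)) = 0"
        then have "lam = 0" "mu *\<^sub>R (u + v) = 0"
          by (simp_all add: add_nonneg_eq_0_iff)
        then show False using L x by simp
      qed
      then show ?R using s x uv by blast
    next
      assume ?R
      then obtain lam mu s where *: "\<bar>lam\<bar> + norm (mu *\<^sub>R (u + v)) \<noteq> 0"
        and s: "s\<^sup>2 = u * qcnj v" and x: "x = lam *\<^sub>R s + mu *\<^sub>R (u + v)"
        by blast
      have "x \<noteq> 0"
      proof
        assume "x = 0"
        \<comment> \<open>As \<open>u + v\<close> is pure, the real part of \<open>x\<close>
          isolates \<open>lam\<close>.\<close>
        moreover have "qRe x = lam * qRe s" using pure x by simp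
        ultimately have "lam = 0" using sol(1)[OF s] by simp
        then show False using * x \<open>x = 0\<close> by simp
      qed
      moreover have "u * x = lam *\<^sub>R (u * s) + mu *\<^sub>R (u * (u + v))"
        unfolding x by (simp add: ring_distribs)
      then have "u * x = x * v"
        unfolding sol(2)[OF s] sylvester_sum_solution[OF pure norm_eq]
        by (simp add: x ring_distribs)
      ultimately show ?L by blast
    qed
  next
    case True
    then have v: "v = - u" by (simp add: add_eq_0_iff)
    have w: "u * qcnj v = - of_real ((norm u)\<^sup>2)"
      using pure v by (simp add: qcnj_pure square_pure del: of_real_power)
    have sol: "u * x = x * v \<longleftrightarrow> qRe x = 0 \<and> u \<bullet> x = 0" for x
      using anticommute_pure_iff[OF pure(1) u0] v by simp
    have im: "u \<bullet> qIm x = u \<bullet> x" for x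
      using pure by (simp add: inner_quat_def)
    show ?thesis
    proof
      assume L: ?L
      \<comment> \<open>A solution \<open>x\<close> is pure here, so rescaling it to modulus
        \<open>|u|\<close> gives a square root of \<open>-|u|^2\<close>.\<close>
      define s where "s = (norm u / norm x) *\<^sub>R x"
      have "s\<^sup>2 = (norm u / norm x)\<^sup>2 *\<^sub>R (x * x)"
        by (simp add: s_def power2_eq_square)
      also have "\<dots> = u * qcnj v"
        using L sol[of x]
        by (simp add: w square_pure power_divide quat_eq_iff del: of_real_power)
      finally have "s\<^sup>2 = u * qcnj v" .
      moreover have "x = (norm x / norm u) *\<^sub>R s + 0 *\<^sub>R (u + v)"
        using L u0 by (simp add: s_def)
      moreover have "\<bar>norm x / norm u\<bar> + norm (0 *\<^sub>R (u + v)) \<noteq> 0"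
        using L u0 by simp
      moreover have "u \<bullet> qIm x = 0" using L sol[of x] im by simp
      ultimately show ?R by blast
    next
      assume ?R
      \<comment> \<open>With \<open>u + v = 0\<close> the \<open>mu\<close> term disappears, so the
        nonvanishing condition becomes \<open>lam \<noteq> 0\<close>.\<close>
      then obtain lam s where lam: "lam \<noteq> 0"
        and s: "s\<^sup>2 = u * qcnj v" and x: "x = lam *\<^sub>R s" and "u \<bullet> x = 0"
        using True v im by auto
      moreover have "qRe s = 0"
        using square_eq_neg_real_imp_pure[of s "norm u"] s u0 unfolding w by simp
      moreover have "s \<noteq> 0" using s u0 unfolding w by auto
      ultimately show ?L using sol[of x] by simp
    qed
  qed
  then show ?thesis unfolding eq qIm_add u_def[symmetric] v_def[symmetric] by blast
qed

end
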